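(* Assume that $\mathbb K$ is an infinite field of characteristic not $2$ and that $(\mathcal X^+,\mathcal X^-)=(\mathrm{Gras}_{p,q}(\mathbb K),\mathrm{Gras}_{q,p}(\mathbb K))$ is the Grassmannian geometry of $p$- and $q$-dimensional subspaces in a finite-dimensional vector space $\mathfrak m\cong\mathbb K^{p+q}$. Then all intrinsic subspaces of $\mathcal X^+$ have the form $$\mathcal I_{\mathfrak e}=\{x\in\mathcal X^+ : \mathfrak e_1\subset x\subset\mathfrak e_2\}$$ for some flag of length three, $\mathfrak e=(\mathfrak e_1\subset\mathfrak e_2\subset\mathfrak m)$, such that $\dim\mathfrak e_1\le p\le\dim\mathfrak e_2$. The principal intrinsic subspaces are precisely the intrinsic subspaces $\mathcal I_{\mathfrak e}$ with $p-\dim\mathfrak e_1=\dim\mathfrak e_2-p$.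
   Context: Flags: a flag of length $k$ in $\mathfrak m$ is a sequence of ascending linear subspaces $0\subset\mathfrak f_1\subset\mathfrak f_2\subset\dots\subset\mathfrak f_{k-1}\subset\mathfrak f_k=\mathfrak m$ in which all inclusions are assumed to be strict, so that the length is the number of inclusions. A flag of length three is thus $0\subsetneq\mathfrak e_1\subsetneq\mathfrak e_2\subsetneq\mathfrak m$. (In the definition of $\mathcal I_{\mathfrak e}$, the inclusions $\mathfrak e_1\subset x\subset\mathfrak e_2$ are not required to be strict.) Grassmannian geometry: $\mathcal X^+$ is the set of $p$-dimensional subspaces of $\mathfrak m$ and $\mathcal X^-$ the set of $q$-dimensional subspaces; $x\top\alpha$ means $\mathfrak m=x\oplus\alpha$. For $\alpha\in\mathcal X^-$ put $\mathfrak v_\alpha=\{x\in\mathcal X^+ : x\top\alpha\}$. For $x\in\mathfrak v_\alpha$, the set $\mathfrak v_\alpha$ is a $\mathbb K$-vector space, denoted $(\mathfrak v_\alpha,x)$, with zero vector $x$, via the bijection $\mathrm{Hom}(x,\alpha)\to\mathfrak v_\alpha$, $f\mapsto\{u+f(u):u\in x\}$; the underlying affine structure does not depend on $x$. A subset $\mathcal I\subset\mathcal X^+$ is an intrinsic subspace if for all $\alpha\in\mathcal X^-$ with $\mathfrak v_\alpha\cap\mathcal I\neq\emptyset$ and all $x\in\mathfrak v_\alpha\cap\mathcal I$, the set $\mathfrak v_\alpha\cap\mathcal I$ is a linear subspace of $(\mathfrak v_\alpha,x)$. Arbitrary intersections of intrinsic subspaces are intrinsic subspaces. For $x,y\in\mathcal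 X^+$, $x\vee y$ denotes the intersection of all intrinsic subspaces containing $x$ and $y$; it is called the principal intrinsic subspace generated by $x$ and $y$.
   Formalization: The first assertion is stated for nonempty intrinsic subspaces (the empty set is vacuously intrinsic), and flags 0 ⊂ e1 ⊂ e2 ⊂ m have weak inclusions, since with strict ones the whole space X^+ and the principal subspaces {x} are counterexamples. *)

theory Defs
  imports Complex_Main "HOL-Library.Function_Algebras"
begin

locale grassmannian_geometry = finite_dimensional_vector_space scale Basis
  for scale :: "'k::field \<Rightarrow> 'm::ab_group_add \<Rightarrow> 'm"  (infixr \<open>*s\<close> 75)
    and Basis :: "'m set" +
  fixes p q :: nat
  assumes dim_total: "dim (UNIV :: 'm set) = p + q"
begin

definition X_plus :: "'m set set" where
  "X_plus = {x. subspace x \<and> dim x = p}"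

definition X_minus :: "'m set set" where
  "X_minus = {\<alpha>. subspace \<alpha> \<and> dim \<alpha> = q}"

definition transversal :: "'m set \<Rightarrow> 'm set \<Rightarrow> bool" where
  "transversal x \<alpha> \<longleftrightarrow> x \<inter> \<alpha> = {0} \<and> {u + v |u v. u \<in> x \<and> v \<in> \<alpha>} = UNIV"

definition affine_chart :: "'m set \<Rightarrow> 'm set set" where
  "affine_chart \<alpha> = {x \<in> X_plus. transversal x \<alpha>}"

(* A linear map from the subspace x to the subspace alpha is represented by its extension by 0
   outside x. Thus each map has exactly one representative, and the vector space structure of
   Hom(x, alpha) is the pointwise one. *)
definition hom_on :: "'m set \<Rightarrow> 'm set \<Rightarrow> ('m \<Rightarrow> 'm) set" where
  "hom_on x \<alpha> = {f. (\<forall>u\<in>x. f u \<in> \<alpha>) \<and> (\<forall>u\<in>x. \<forall>v\<in>x. f (u + v) = f u + f v) \<and>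
     (\<forall>c. \<forall>u\<in>x. f (c *s u) = c *s f u) \<and> (\<forall>u. u \<notin> x \<longrightarrow> f u = 0)}"

definition graph_on :: "'m set \<Rightarrow> ('m \<Rightarrow> 'm) \<Rightarrow> 'm set" where
  "graph_on x f = {u + f u |u. u \<in> x}"

(* For x in affine_chart alpha, graph_on x maps hom_on x alpha bijectively onto affine_chart
   alpha and sends 0 to x. The vector space structure of the chart with zero vector x is the
   one transported along this bijection, so its linear subspaces are the images of the linear
   subspaces of hom_on x alpha. *)
definition chart_subspace :: "'m set \<Rightarrow> 'm set \<Rightarrow> 'm set set \<Rightarrow> bool" where
  "chart_subspace \<alpha> x S \<longleftrightarrow>
     (\<exists>F \<subseteq> hom_on x \<alpha>. module.subspace (\<lambda>c f u. c *s f u) F \<and> S = graph_on x ` F)"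

(* The empty set satisfies this condition vacuously. *)
definition intrinsic_subspace :: "'m set set \<Rightarrow> bool" where
  "intrinsic_subspace I \<longleftrightarrow> I \<subseteq> X_plus \<and>
     (\<forall>\<alpha>\<in>X_minus. \<forall>x \<in> affine_chart \<alpha> \<inter> I. chart_subspace \<alpha> x (affine_chart \<alpha> \<inter> I))"

definition intrinsic_join :: "'m set \<Rightarrow> 'm set \<Rightarrow> 'm set set" where
  "intrinsic_join x y = \<Inter>{I. intrinsic_subspace I \<and> x \<in> I \<and> y \<in> I}"

definition principal_intrinsic_subspace :: "'m set set \<Rightarrow> bool" where
  "principal_intrinsic_subspace I \<longleftrightarrow> (\<exists>x\<in>X_plus. \<exists>y\<in>X_plus. I = intrinsic_join x y)"

(* flag3 e1 e2: 0 <= e1 <= e2 <= m is a flag of length three in m = UNIV with weak inclusions.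
   Strict inclusions would exclude all of X_plus (e1 = 0, e2 = m), the principal intrinsic
   subspaces {x} (e1 = e2 = x), and the joins of x and y with x Int y = 0 (e1 = 0) or with
   x + y = m (e2 = m). *)
definition flag3 :: "'m set \<Rightarrow> 'm set \<Rightarrow> bool" where
  "flag3 e1 e2 \<longleftrightarrow> subspace e1 \<and> subspace e2 \<and> e1 \<subseteq> e2"

definition flag_subspace :: "'m set \<Rightarrow> 'm set \<Rightarrow> 'm set set" where
  "flag_subspace e1 e2 = {x \<in> X_plus. e1 \<subseteq> x \<and> x \<subseteq> e2}"

end

end

theory Submission
  imports Defs
begin

text \<open>
  Fix a point \<open>x\<close> of an intrinsic subspace \<open>I\<close> and a complement \<open>\<alpha>\<close> of \<open>x\<close>. In the chart of \<open>\<alpha>\<close>, \<open>I\<close> is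
  a linear space of maps \<open>f : x \<rightarrow> \<alpha>\<close>. Comparing this chart with the one of the complement
  \<open>{b + \<psi>(b) v | b \<in> \<alpha>}\<close>, where \<open>v \<in> x\<close> and \<open>\<psi>\<close> is a linear functional, shows that this space contains
  with \<open>f\<close> also \<open>u \<mapsto> \<psi>(f u) f(v)\<close>, so that it is an inner ideal. Polarization then shows that
  nonzero \<open>\<phi> \<otimes> a\<close> and \<open>\<chi> \<otimes> b\<close> in the space imply \<open>\<phi> \<otimes> b\<close> in it, whence it consists of all maps that vanish
  on a subspace \<open>e\<^sub>1\<close> of \<open>x\<close> and take values in a subspace \<open>e\<^sub>2\<close> containing \<open>x\<close>. Rank one maps survive any change
  of the complement, so \<open>e\<^sub>1\<close> and \<open>e\<^sub>2\<close> depend only on \<open>x\<close> and \<open>I\<close>; as any two points have a common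
  complement, \<open>I\<close> is the flag subspace of \<open>e\<^sub>1\<close> and \<open>e\<^sub>2\<close>. In particular the join of \<open>x\<close> and \<open>y\<close> is
  the flag subspace of \<open>x \<inter> y\<close> and \<open>x + y\<close>.
\<close>

context grassmannian_geometry
begin

section \<open>Linear maps and functionals\<close>

abbreviation endomorphism :: "('m \<Rightarrow> 'm) \<Rightarrow> bool" where
  "endomorphism f \<equiv> Vector_Spaces.linear scale scale f"

abbreviation functional :: "('m \<Rightarrow> 'k) \<Rightarrow> bool" where
  "functional \<phi> \<equiv> Vector_Spaces.linear scale (*) \<phi>"

abbreviation rank_one :: "('m \<Rightarrow> 'k) \<Rightarrow> 'm \<Rightarrow> 'm \<Rightarrow> 'm" where
  "rank_one \<phi> a \<equiv> \<lambda>u. \<phi> u *s a"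

text \<open>Gives access to the extension of maps from independent sets, with values in the field
  itself.\<close>

lemma vector_space_pair_field: "vector_space_pair scale ((*) :: 'k \<Rightarrow> 'k \<Rightarrow> 'k)"
  by unfold_locales (auto simp: algebra_simps)

lemma endomorphism_iff:
  "endomorphism f \<longleftrightarrow> (\<forall>u v. f (u + v) = f u + f v) \<and> (\<forall>c u. f (c *s u) = c *s f u)"
  using vector_space_axioms by (simp add: Vector_Spaces.linear_iff)

lemma functional_iff:
  "functional \<phi> \<longleftrightarrow> (\<forall>u v. \<phi> (u + v) = \<phi> u + \<phi> v) \<and> (\<forall>c u. \<phi> (c *s u) = c * \<phi> u)"
proof -
  interpret vp: vector_space_pair scale "(*) :: 'k \<Rightarrow> 'k \<Rightarrow> 'k"
    by (rule vector_space_pair_field)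
  show ?thesis
    using vector_space_axioms vp.vs2.vector_space_axioms by (simp add: Vector_Spaces.linear_iff)
qed

lemma functional_add: "functional \<phi> \<Longrightarrow> \<phi> (u + v) = \<phi> u + \<phi> v"
  by (simp add: functional_iff)

lemma functional_scale: "functional \<phi> \<Longrightarrow> \<phi> (c *s u) = c * \<phi> u"
  by (simp add: functional_iff)

lemma endomorphism_diff: "endomorphism f \<Longrightarrow> f (u - v) = f u - f v"
  by (metis endomorphism_iff add_diff_cancel diff_add_cancel)

lemma functional_diff: "functional \<phi> \<Longrightarrow> \<phi> (u - v) = \<phi> u - \<phi> v"
  by (metis functional_iff add_diff_cancel diff_add_cancel)

lemma functional_zero: "functional \<phi> \<Longrightarrow> \<phi> 0 = 0"
  by (metis functional_diff diff_self)

text \<open>A basis of \<open>S\<close> stays independent when \<open>a\<close> is added, so the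
  value 1 at \<open>a\<close> and 0 on the basis can be prescribed.\<close>

lemma functional_separating:
  assumes "subspace S" and "a \<notin> S"
  obtains \<psi> where "functional \<psi>" "\<psi> a = 1" "\<And>u. u \<in> S \<Longrightarrow> \<psi> u = 0"
proof -
  interpret vp: vector_space_pair scale "(*) :: 'k \<Rightarrow> 'k \<Rightarrow> 'k"
    by (rule vector_space_pair_field)
  obtain B where B: "B \<subseteq> S" "independent B" "span B = S"
    using basis_subspace_exists[OF assms(1)] by metis
  have "independent (insert a B)"
    using B assms(2) by (simp add: independent_insert)
  then obtain \<psi> where \<psi>: "functional \<psi>" "\<forall>u\<in>insert a B. \<psi> u = (if u = a then 1 else 0)"
    using vp.linear_independent_extend[of "insert a B" "\<lambda>u. if u = a then 1 else 0"] by blast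
  have "\<psi> u = 0" if "u \<in> S" for u
  proof (rule vp.linear_eq_0_on_span[OF \<psi>(1)])
    show "u \<in> span B" using that B by simp
    show "\<psi> b = 0" if "b \<in> B" for b
      using that \<psi>(2) B(1) assms(2) by auto
  qed
  with \<psi> show thesis using that[of \<psi>] by auto
qed

section \<open>Transversality and common complements\<close>

lemma transversal_Int: "transversal x \<alpha> \<Longrightarrow> u \<in> x \<Longrightarrow> u \<in> \<alpha> \<Longrightarrow> u = 0"
  by (auto simp: transversal_def)

lemma transversal_decompose:
  assumes "transversal x \<alpha>"
  obtains u a where "u \<in> x" "a \<in> \<alpha>" "v = u + a"
  using assms unfolding transversal_def by blast

lemma dim_transversal:
  assumes "subspace x" "subspace \<alpha>" "transversal x \<alpha>"
  shows "dim x + dim \<alpha> = p + q"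
  using dim_sums_Int[OF assms(1,2)] assms(3) dim_total by (simp add: transversal_def)

lemma transversalI_dim:
  assumes "subspace x" "subspace \<alpha>" "x \<inter> \<alpha> = {0}" "dim x + dim \<alpha> = p + q"
  shows "transversal x \<alpha>"
proof -
  have "dim {u + v |u v. u \<in> x \<and> v \<in> \<alpha>} = dim (UNIV :: 'm set)"
    using dim_sums_Int[OF assms(1,2)] assms(3,4) dim_total by simp
  then have "{u + v |u v. u \<in> x \<and> v \<in> \<alpha>} = UNIV"
    by (intro subspace_dim_equal subspace_sums assms) auto
  with assms(3) show ?thesis by (simp add: transversal_def)
qed

text \<open>The component in \<open>x\<close> modulo \<open>\<alpha>\<close> is unique, and
  uniqueness forces it to depend linearly on the vector.\<close>

lemma transversal_projection:
  assumes "subspace x" "subspace \<alpha>" "transversal x \<alpha>"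
  obtains P where "endomorphism P" "\<And>u. P u \<in> x" "\<And>u. u - P u \<in> \<alpha>"
    "\<And>u. u \<in> x \<Longrightarrow> P u = u" "\<And>a. a \<in> \<alpha> \<Longrightarrow> P a = 0"
proof -
  have "\<exists>w. w \<in> x \<and> u - w \<in> \<alpha>" for u
    using transversal_decompose[OF assms(3), of u] by (metis add_diff_cancel_left')
  then obtain P where P: "\<And>u. P u \<in> x" "\<And>u. u - P u \<in> \<alpha>" by metis
  have uniq: "P u = w" if "w \<in> x" "u - w \<in> \<alpha>" for u w
  proof -
    have "P u - w = (u - w) - (u - P u)" by simp
    also have "\<dots> \<in> \<alpha>" using subspace_diff[OF assms(2) that(2) P(2)] .
    finally have "P u - w = 0"
      using transversal_Int[OF assms(3)] subspace_diff[OF assms(1) P(1) that(1)] by blast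
    then show ?thesis by simp
  qed
  have "P (u + v) = P u + P v" for u v
    using subspace_add[OF assms(2) P(2)[of u] P(2)[of v]] P
    by (intro uniq subspace_add[OF assms(1)]) (auto simp: algebra_simps)
  moreover have "P (c *s u) = c *s P u" for c u
    using subspace_scale[OF assms(2) P(2)[of u], of c] P
    by (intro uniq subspace_scale[OF assms(1)]) (auto simp: algebra_simps)
  ultimately have "endomorphism P" by (simp add: endomorphism_iff)
  moreover have "P u = u" if "u \<in> x" for u
    using that subspace_0[OF assms(2)] by (intro uniq) auto
  moreover have "P a = 0" if "a \<in> \<alpha>" for a
    using that subspace_0[OF assms(1)] by (intro uniq) auto
  ultimately show thesis using P that by blast
qed

text \<open>If the union were everything, a vector \<open>s\<close> outside \<open>S\<close> would
  lie in \<open>T\<close> and a vector \<open>t\<close> outside \<open>T\<close> in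
  \<open>S\<close>; then \<open>s + t\<close> is in neither.\<close>

lemma subspace_Un_proper:
  assumes "subspace S" "subspace T" "S \<noteq> UNIV" "T \<noteq> UNIV"
  shows "S \<union> T \<noteq> UNIV"
proof
  assume eq: "S \<union> T = UNIV"
  obtain s t where st: "s \<notin> S" "t \<notin> T" using assms(3,4) by auto
  with eq have "s \<in> T" "t \<in> S" by auto
  have "s + t \<notin> S"
    using st subspace_diff[OF assms(1) _ \<open>t \<in> S\<close>, of "s + t"] by auto
  moreover have "s + t \<notin> T"
    using st subspace_diff[OF assms(2) _ \<open>s \<in> T\<close>, of "s + t"] by auto
  ultimately show False using eq by auto
qed

text \<open>A vector of \<open>x\<close> of the form \<open>k *s v + a\<close> with
  \<open>k \<noteq> 0\<close> and \<open>a \<in> \<alpha>\<close> could be solved for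
  \<open>v\<close>. This is the enlargement step in the construction of a common complement.\<close>

lemma Int_span_insert_trivial:
  assumes "subspace x" "subspace \<alpha>" "x \<inter> \<alpha> = {0}" "v \<notin> {u + a |u a. u \<in> x \<and> a \<in> \<alpha>}"
  shows "x \<inter> span (insert v \<alpha>) = {0}"
proof -
  have "w = 0" if w: "w \<in> x" "w \<in> span (insert v \<alpha>)" for w
  proof -
    obtain k where k: "w - k *s v \<in> span \<alpha>" using w span_breakdown_eq by blast
    then have k': "w - k *s v \<in> \<alpha>" using assms(2) by (metis span_eq_iff)
    have "k = 0"
    proof (rule ccontr)
      assume "k \<noteq> 0"
      have "v = inverse k *s w + (- inverse k) *s (w - k *s v)"
        using \<open>k \<noteq> 0\<close> by (simp add: scale_right_diff_distrib)
      moreover have "inverse k *s w \<in> x" using assms(1) w(1) by (rule subspace_scale)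
      moreover have "(- inverse k) *s (w - k *s v) \<in> \<alpha>" using assms(2) k' by (rule subspace_scale)
      ultimately show False using assms(4) by blast
    qed
    with k' w assms(3) show ?thesis by auto
  qed
  then show ?thesis using subspace_0[OF assms(1)] span_zero by auto
qed

text \<open>Take \<open>\<alpha>\<close> of greatest dimension among the subspaces meeting both
  \<open>x\<close> and \<open>y\<close> trivially. If neither x + \<alpha> nor y + \<alpha> were the
  whole space, some vector would lie outside both and \<open>\<alpha>\<close> could be
  enlarged.\<close>

lemma common_complement:
  assumes x: "x \<in> X_plus" and y: "y \<in> X_plus"
  obtains \<alpha> where "\<alpha> \<in> X_minus" "transversal x \<alpha>" "transversal y \<alpha>"
proof -
  have sx: "subspace x" "dim x = p" and sy: "subspace y" "dim y = p"
    using x y by (auto simp: X_plus_def)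
  define Q where "Q \<alpha> \<longleftrightarrow> subspace \<alpha> \<and> x \<inter> \<alpha> = {0} \<and> y \<inter> \<alpha> = {0}" for \<alpha>
  have "Q {0}" using sx sy by (auto simp: Q_def subspace_single_0 subspace_0)
  moreover have "dim \<alpha> < Suc (p + q)" for \<alpha> :: "'m set"
    using dim_subset[of \<alpha> UNIV] dim_total by simp
  ultimately obtain \<alpha> where \<alpha>: "Q \<alpha>" and mx: "\<And>\<beta>. Q \<beta> \<Longrightarrow> dim \<beta> \<le> dim \<alpha>"
    using ex_has_greatest_nat[of Q "{0}" dim "Suc (p + q)"] by (metis less_imp_le)
  let ?S = "{u + a |u a. u \<in> x \<and> a \<in> \<alpha>}"
  let ?T = "{u + a |u a. u \<in> y \<and> a \<in> \<alpha>}"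
  have sub: "subspace \<alpha>" "x \<inter> \<alpha> = {0}" "y \<inter> \<alpha> = {0}" using \<alpha> by (auto simp: Q_def)
  have "?S = UNIV \<or> ?T = UNIV"
  proof (rule ccontr)
    assume "\<not> ?thesis"
    then have "?S \<union> ?T \<noteq> UNIV"
      by (intro subspace_Un_proper subspace_sums sx sy sub) auto
    then obtain v where v: "v \<notin> ?S" "v \<notin> ?T" by blast
    have "Q (span (insert v \<alpha>))"
      unfolding Q_def
      by (intro conjI subspace_span Int_span_insert_trivial sx sy sub v)
    then have le: "dim (insert v \<alpha>) \<le> dim \<alpha>" using mx by fastforce
    have "v \<notin> \<alpha>"
    proof
      assume "v \<in> \<alpha>"
      then have "0 + v \<in> ?S" using subspace_0[OF sx(1)] by blast
      with v(1) show False by (simp only: add_0)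
    qed
    then have "v \<notin> span \<alpha>" using sub(1) by (metis span_eq_iff)
    with le show False by (simp add: dim_insert)
  qed
  \<comment> \<open>One full sum is enough: \<open>x\<close> and \<open>y\<close> both have
    dimension \<open>p\<close>, so \<open>dim \<alpha> = q\<close>, and then both trivial
    intersections are transversal by dimension.\<close>
  then have "dim ?S = p + q \<or> dim ?T = p + q" using dim_total by auto
  then have dim: "dim \<alpha> = q"
    using dim_sums_Int[OF sx(1) sub(1)] dim_sums_Int[OF sy(1) sub(1)] sx sy sub by auto
  then show thesis
    using sx sy sub by (intro that transversalI_dim) (auto simp: X_minus_def)
qed

section \<open>Graphs over a point and the linear structure of charts\<close>

lemma graph_on_cong: "(\<And>u. u \<in> x \<Longrightarrow> f u = g u) \<Longrightarrow> graph_on x f = graph_on x g"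
  unfolding graph_on_def by force

lemma graph_on_zero: "(\<And>u. u \<in> x \<Longrightarrow> f u = 0) \<Longrightarrow> graph_on x f = x"
  unfolding graph_on_def by force

lemma graph_on_inj:
  assumes "subspace x" "subspace \<alpha>" "transversal x \<alpha>"
    and "f \<in> hom_on x \<alpha>" "g \<in> hom_on x \<alpha>" "graph_on x f = graph_on x g"
  shows "f = g"
proof
  fix u
  show "f u = g u"
  proof (cases "u \<in> x")
    case True
    then have "u + f u \<in> graph_on x g" using assms(6) by (auto simp: graph_on_def)
    then obtain v where v: "v \<in> x" "u + f u = v + g v" by (auto simp: graph_on_def)
    then have eq: "u - v = g v - f u" by (simp add: algebra_simps)
    moreover have "g v - f u \<in> \<alpha>"
      using assms(2,4,5) True v by (auto simp: hom_on_def intro: subspace_diff)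
    moreover have "u - v \<in> x" using assms(1) True v by (auto intro: subspace_diff)
    ultimately have "u - v = 0" by (metis transversal_Int[OF assms(3)])
    with eq show ?thesis by simp
  next
    case False
    then show ?thesis using assms(4,5) by (auto simp: hom_on_def)
  qed
qed

text \<open>Only the restriction to \<^term>\<open>x\<close> of a map matters for its graph over \<^term>\<open>x\<close>, so points of a
  chart can be described by endomorphisms of the whole space, without extending by zero.\<close>

lemma chart_graph:
  assumes "subspace x" "subspace y" "subspace \<alpha>" "transversal x \<alpha>" "transversal y \<alpha>"
  obtains f where "endomorphism f" "\<And>u. f u \<in> \<alpha>" "graph_on x f = y"
proof -
  obtain P where P: "endomorphism P" "\<And>u. P u \<in> y" "\<And>u. u - P u \<in> \<alpha>"
    "\<And>u. u \<in> y \<Longrightarrow> P u = u" "\<And>a. a \<in> \<alpha> \<Longrightarrow> P a = 0"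
    using transversal_projection[OF assms(2,3,5)] by blast
  \<comment> \<open>\<open>P\<close> projects onto \<open>y\<close> along \<open>\<alpha>\<close>,
    so \<open>u + f u\<close> is the point of \<open>y\<close> congruent to \<open>u\<close> modulo
    \<open>\<alpha>\<close>.\<close>
  define f where "f u = P u - u" for u
  have "endomorphism f"
    using P(1) by (auto simp: endomorphism_iff f_def algebra_simps)
  moreover have "f u \<in> \<alpha>" for u
    using subspace_neg[OF assms(3) P(3)[of u]] by (simp add: f_def)
  moreover have "graph_on x f = y"
  proof
    show "graph_on x f \<subseteq> y" using P(2) by (auto simp: graph_on_def f_def)
    show "y \<subseteq> graph_on x f"
    proof
      fix w assume w: "w \<in> y"
      obtain u a where ua: "u \<in> x" "a \<in> \<alpha>" "w = u + a"
        using transversal_decompose[OF assms(4)] by metis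
      have "P u = w" using P(1,4,5) w ua unfolding endomorphism_iff by (metis add.right_neutral)
      then have "w = u + f u" by (simp add: f_def)
      with ua show "w \<in> graph_on x f" by (auto simp: graph_on_def)
    qed
  qed
  ultimately show thesis using that by blast
qed

text \<open>A vector \<open>u + f u\<close> in \<open>\<alpha>\<close> has \<open>u\<close> in both
  \<open>x\<close> and \<open>\<alpha>\<close>, so the graph is again a complement of
  \<open>\<alpha>\<close>; its dimension follows from transversality.\<close>

lemma graph_in_chart:
  assumes "x \<in> X_plus" "\<alpha> \<in> X_minus" "transversal x \<alpha>" and f: "f \<in> hom_on x \<alpha>"
  shows "graph_on x f \<in> affine_chart \<alpha>"
proof -
  have sx: "subspace x" "dim x = p" and sa: "subspace \<alpha>" "dim \<alpha> = q"
    using assms by (auto simp: X_plus_def X_minus_def)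
  have fa: "f u \<in> \<alpha>" "f (u + v) = f u + f v" "f (c *s u) = c *s f u"
    if "u \<in> x" "v \<in> x" for u v c
    using f that by (auto simp: hom_on_def)
  have f0: "f 0 = 0" using fa(2)[of 0 0] subspace_0[OF sx(1)] by auto
  have sub: "subspace (graph_on x f)"
  proof (rule subspaceI)
    show "0 \<in> graph_on x f" using f0 subspace_0[OF sx(1)] by (force simp: graph_on_def)
    fix c w w' assume "w \<in> graph_on x f"
    then obtain u where u: "u \<in> x" "w = u + f u" by (auto simp: graph_on_def)
    then show "c *s w \<in> graph_on x f"
      using fa(3)[of u u c] subspace_scale[OF sx(1), of u c]
      by (auto simp: graph_on_def scale_right_distrib intro!: exI[of _ "c *s u"])
    assume "w' \<in> graph_on x f"
    then obtain v where v: "v \<in> x" "w' = v + f v" by (auto simp: graph_on_def)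
    then show "w + w' \<in> graph_on x f"
      using u fa(2)[of u v] subspace_add[OF sx(1), of u v]
      by (auto simp: graph_on_def algebra_simps intro!: exI[of _ "u + v"])
  qed
  have tr: "transversal (graph_on x f) \<alpha>"
  proof -
    have "w = 0" if w: "w \<in> graph_on x f" "w \<in> \<alpha>" for w
    proof -
      obtain u where u: "u \<in> x" "w = u + f u" using w by (auto simp: graph_on_def)
      then have "u \<in> \<alpha>" using subspace_diff[OF sa(1) w(2) fa(1)[of u]] by auto
      then show ?thesis using u f0 transversal_Int[OF assms(3)] by fastforce
    qed
    moreover have "v \<in> {u + a |u a. u \<in> graph_on x f \<and> a \<in> \<alpha>}" for v
    proof -
      obtain u a where ua: "u \<in> x" "a \<in> \<alpha>" "v = u + a"
        using transversal_decompose[OF assms(3)] by metis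
      then have "v = (u + f u) + (a - f u)" "u + f u \<in> graph_on x f" "a - f u \<in> \<alpha>"
        using fa(1) sa(1) by (auto simp: graph_on_def intro: subspace_diff)
      then show ?thesis by blast
    qed
    ultimately show ?thesis
      using subspace_0[OF sub] subspace_0[OF sa(1)] by (auto simp: transversal_def)
  qed
  then have "dim (graph_on x f) = p" using dim_transversal[OF sub sa(1)] sa by simp
  with sub tr show ?thesis by (simp add: affine_chart_def X_plus_def)
qed


text \<open>Needed to unfold the notion of linear subspace that occurs in
  \<open>chart_subspace\<close>.\<close>

lemma module_maps: "module (\<lambda>c (f :: 'm \<Rightarrow> 'm) u. c *s f u)"
  by unfold_locales (auto simp: fun_eq_iff algebra_simps)

text \<open>Restates the chart condition for endomorphisms. The extension by zero \<open>R h\<close>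
  has the same graph over \<open>x\<close> as \<open>h\<close>, and injectivity of
  \<open>graph_on x\<close> on \<open>hom_on x \<alpha>\<close> puts it into the given linear
  subspace \<open>F\<close>.\<close>

lemma intrinsic_chart_closed:
  assumes I: "intrinsic_subspace I" "x \<in> I" and \<alpha>: "\<alpha> \<in> X_minus" "transversal x \<alpha>"
    and f: "endomorphism f" "\<forall>u\<in>x. f u \<in> \<alpha>" "graph_on x f \<in> I"
    and g: "endomorphism g" "\<forall>u\<in>x. g u \<in> \<alpha>" "graph_on x g \<in> I"
  shows "graph_on x (\<lambda>u. c *s f u + d *s g u) \<in> I"
proof -
  have x: "x \<in> X_plus" using I by (auto simp: intrinsic_subspace_def)
  then have sub: "subspace x" "subspace \<alpha>" using \<alpha> by (auto simp: X_plus_def X_minus_def)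
  have "x \<in> affine_chart \<alpha> \<inter> I" using x I \<alpha> by (simp add: affine_chart_def)
  then have "chart_subspace \<alpha> x (affine_chart \<alpha> \<inter> I)"
    using I(1) \<alpha>(1) by (auto simp: intrinsic_subspace_def)
  then obtain F where F: "F \<subseteq> hom_on x \<alpha>" "module.subspace (\<lambda>c f u. c *s f u) F"
      "affine_chart \<alpha> \<inter> I = graph_on x ` F"
    by (auto simp: chart_subspace_def)
  define R where "R h u = (if u \<in> x then h u else 0)" for h :: "'m \<Rightarrow> 'm" and u
  have R: "R h \<in> F" if h: "endomorphism h" "\<forall>u\<in>x. h u \<in> \<alpha>" "graph_on x h \<in> I" for h
  proof -
    have Rh: "R h \<in> hom_on x \<alpha>"
      using h(1,2) subspace_add[OF sub(1)] subspace_scale[OF sub(1)]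
      by (auto simp: hom_on_def R_def endomorphism_iff)
    have "graph_on x (R h) = graph_on x h" by (rule graph_on_cong) (simp add: R_def)
    then have "graph_on x (R h) \<in> affine_chart \<alpha> \<inter> I"
      using graph_in_chart[OF x \<alpha> Rh] h(3) by simp
    then obtain k where "k \<in> F" "graph_on x (R h) = graph_on x k" using F(3) by auto
    then show ?thesis using graph_on_inj[OF sub \<alpha>(2) Rh] F(1) by auto
  qed
  have "(\<lambda>u. c *s R f u) + (\<lambda>u. d *s R g u) \<in> F"
    using F(2) R[OF f] R[OF g] unfolding module.subspace_def[OF module_maps] by blast
  moreover have "graph_on x ((\<lambda>u. c *s R f u) + (\<lambda>u. d *s R g u)) =
      graph_on x (\<lambda>u. c *s f u + d *s g u)"
    by (rule graph_on_cong) (simp add: R_def)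
  ultimately have "graph_on x (\<lambda>u. c *s f u + d *s g u) \<in> graph_on x ` F" by (metis image_eqI)
  then show ?thesis using F(3) by blast
qed

end

section \<open>Directions of an intrinsic subspace at a base point\<close>

locale pointed_intrinsic_subspace = grassmannian_geometry scale Basis p q
  for scale :: "'k::field \<Rightarrow> 'm::ab_group_add \<Rightarrow> 'm"  (infixr \<open>*s\<close> 75)
    and Basis :: "'m set" and p q :: nat +
  fixes I :: "'m set set" and x :: "'m set"
  assumes infinite_field: "infinite (UNIV :: 'k set)"
    and intrinsic: "intrinsic_subspace I"
    and point: "x \<in> I"
begin

lemma point_X_plus: "x \<in> X_plus"
  using intrinsic point by (auto simp: intrinsic_subspace_def)

lemma subspace_point: "subspace x" and dim_point: "dim x = p"
  using point_X_plus by (auto simp: X_plus_def)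

definition complement :: "'m set \<Rightarrow> bool" where
  "complement \<alpha> \<longleftrightarrow> \<alpha> \<in> X_minus \<and> transversal x \<alpha>"

lemma subspace_complement: "complement \<alpha> \<Longrightarrow> subspace \<alpha>"
  by (simp add: complement_def X_minus_def)

text \<open>The part of \<open>I\<close> in the chart of \<open>\<alpha>\<close>, as maps with
  \<open>x\<close> as origin. Endomorphisms are used instead of \<open>hom_on x \<alpha>\<close>:
  their values outside \<open>x\<close> are arbitrary, and different members may give the same
  point.\<close>

definition directions :: "'m set \<Rightarrow> ('m \<Rightarrow> 'm) set" where
  "directions \<alpha> = {f. endomorphism f \<and> (\<forall>u\<in>x. f u \<in> \<alpha>) \<and> graph_on x f \<in> I}"

lemma directions_lincomb:
  assumes \<alpha>: "complement \<alpha>" and f: "f \<in> directions \<alpha>" and g: "g \<in> directions \<alpha>"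
  shows "(\<lambda>u. c *s f u + d *s g u) \<in> directions \<alpha>"
proof -
  note sub = subspace_complement[OF \<alpha>]
  have "graph_on x (\<lambda>u. c *s f u + d *s g u) \<in> I"
    using assms intrinsic_chart_closed[OF intrinsic point, of \<alpha> f g]
    by (simp add: complement_def directions_def)
  with f g show ?thesis
    by (auto simp: directions_def endomorphism_iff algebra_simps
        intro!: subspace_add[OF sub] subspace_scale[OF sub])
qed

lemma directions_scale: "complement \<alpha> \<Longrightarrow> f \<in> directions \<alpha> \<Longrightarrow> (\<lambda>u. c *s f u) \<in> directions \<alpha>"
  using directions_lincomb[of \<alpha> f f c 0] by simp

lemma directions_zero:
  assumes "complement \<alpha>" "endomorphism f" "\<And>u. u \<in> x \<Longrightarrow> f u = 0"
  shows "f \<in> directions \<alpha>"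
  using assms point subspace_0[OF subspace_complement[OF assms(1)]]
  by (simp add: directions_def graph_on_zero)

lemma directions_cong:
  assumes "f \<in> directions \<alpha>" "endomorphism g" "\<And>u. u \<in> x \<Longrightarrow> f u = g u"
  shows "g \<in> directions \<alpha>"
  using assms graph_on_cong[of x f g] by (simp add: directions_def)

lemma endomorphism_rank_one: "functional \<phi> \<Longrightarrow> endomorphism (rank_one \<phi> a)"
  by (simp add: functional_iff endomorphism_iff algebra_simps)

text \<open>The substitutions \<open>k\<close> and \<open>k'\<close> of the parameter prove one
  inclusion each.\<close>

lemma graph_on_reparam:
  assumes "\<And>u. u \<in> x \<Longrightarrow> k u \<in> x \<and> u + f u = k u + g (k u)"
    and "\<And>u. u \<in> x \<Longrightarrow> k' u \<in> x \<and> u + g u = k' u + f (k' u)"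
  shows "graph_on x f = graph_on x g"
  using assms unfolding graph_on_def by blast

lemma infinite_field_avoid:
  assumes "finite (T :: 'k set)" obtains t where "t \<notin> T"
  using ex_new_if_finite[OF infinite_field assms] by blast

section \<open>Rank one directions: change of complement, compression, exchange\<close>

text \<open>Moving the value from \<open>a\<close> to \<open>a + w\<close> with
  \<open>w \<in> x\<close> only reparametrizes the graph and rescales the map, and rescaling stays
  within the directions.\<close>

lemma rank_one_transfer:
  assumes \<alpha>: "complement \<alpha>" and \<beta>: "complement \<beta>" and a: "a \<in> \<alpha>" and b: "b \<in> \<beta>"
    and ab: "b - a \<in> x" and \<phi>: "functional \<phi>" and dir: "rank_one \<phi> a \<in> directions \<alpha>"
  shows "rank_one \<phi> b \<in> directions \<beta>"
proof -
  define w where "w = b - a"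
  have bw: "b = a + w" "w \<in> x" using ab by (auto simp: w_def)
  \<comment> \<open>The scalar \<open>s\<close> avoids 0 and the pole of \<open>r\<close> below. If
    \<open>\<phi> w = 0\<close> there is no pole, and the second excluded value is 0 again.\<close>
  obtain s where s: "s \<notin> {0, - inverse (\<phi> w)}" using infinite_field_avoid[of "{0, - inverse (\<phi> w)}"] by auto
  have nz: "s \<noteq> 0" "1 + s * \<phi> w \<noteq> 0"
  proof -
    show "s \<noteq> 0" using s by simp
    show "1 + s * \<phi> w \<noteq> 0"
    proof
      assume "1 + s * \<phi> w = 0"
      then have "\<phi> w \<noteq> 0" "s * \<phi> w = - 1" by (auto simp: add_eq_0_iff)
      then have "s = - inverse (\<phi> w)" by (simp add: field_simps)
      with s show False by simp
    qed
  qed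
  \<comment> \<open>With \<open>v = u + (s * \<phi> u) *s w\<close> one has
    \<open>\<phi> v = \<phi> u * (1 + s * \<phi> w)\<close>, so this \<open>r\<close> is the scalar
    with \<open>r * \<phi> v = s * \<phi> u\<close>.\<close>
  define r where "r = s / (1 + s * \<phi> w)"
  have "graph_on x (rank_one (\<lambda>u. s * \<phi> u) b) = graph_on x (rank_one (\<lambda>u. r * \<phi> u) a)"
  proof (rule graph_on_reparam[where k = "\<lambda>u. u + (s * \<phi> u) *s w" and k' = "\<lambda>u. u - (r * \<phi> u) *s w"])
    fix u assume u: "u \<in> x"
    have "r * \<phi> (u + (s * \<phi> u) *s w) = s * \<phi> u"
      using \<phi> nz by (simp add: functional_iff r_def field_simps)
    then show "u + (s * \<phi> u) *s w \<in> x \<and>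
        u + (s * \<phi> u) *s b = u + (s * \<phi> u) *s w + (r * \<phi> (u + (s * \<phi> u) *s w)) *s a"
      using u bw subspace_add[OF subspace_point] subspace_scale[OF subspace_point]
      by (auto simp: algebra_simps)
    have "s * \<phi> (u - (r * \<phi> u) *s w) = r * \<phi> u"
      using \<phi> nz by (simp add: functional_diff functional_iff r_def field_simps)
    then show "u - (r * \<phi> u) *s w \<in> x \<and>
        u + (r * \<phi> u) *s a = u - (r * \<phi> u) *s w + (s * \<phi> (u - (r * \<phi> u) *s w)) *s b"
      using u bw subspace_diff[OF subspace_point] subspace_scale[OF subspace_point]
      by (auto simp: algebra_simps)
  qed
  moreover have "graph_on x (rank_one (\<lambda>u. r * \<phi> u) a) \<in> I"
    using directions_scale[OF \<alpha> dir, of r] by (simp add: directions_def)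
  ultimately have "rank_one (\<lambda>u. s * \<phi> u) b \<in> directions \<beta>"
    using \<phi> b subspace_scale[OF subspace_complement[OF \<beta>]]
    by (auto simp: directions_def functional_iff intro!: endomorphism_rank_one)
       (auto simp: algebra_simps)
  then have "(\<lambda>u. inverse s *s rank_one (\<lambda>u. s * \<phi> u) b u) \<in> directions \<beta>"
    by (rule directions_scale[OF \<beta>])
  then show ?thesis using nz by (simp add: field_simps)
qed

text \<open>The shear changes each vector of \<open>\<alpha>\<close> only by a multiple of
  \<open>v \<in> x\<close>, hence preserves complementarity to \<open>x\<close>.\<close>

lemma complement_shear:
  assumes \<alpha>: "complement \<alpha>" and v: "v \<in> x" and \<psi>: "functional \<psi>"
  shows "complement ((\<lambda>b. b + \<psi> b *s v) ` \<alpha>)"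
proof -
  let ?h = "\<lambda>b. b + \<psi> b *s v"
  note sa = subspace_complement[OF \<alpha>]
  have tr: "transversal x \<alpha>" using \<alpha> by (simp add: complement_def)
  have sub: "subspace (?h ` \<alpha>)"
  proof (rule subspaceI)
    show "0 \<in> ?h ` \<alpha>" using subspace_0[OF sa] functional_zero[OF \<psi>] by force
    fix c b b' assume "b \<in> ?h ` \<alpha>"
    then obtain a where a: "a \<in> \<alpha>" "b = ?h a" by auto
    then have "c *s b = ?h (c *s a)" using \<psi> by (simp add: functional_iff algebra_simps)
    then show "c *s b \<in> ?h ` \<alpha>" using subspace_scale[OF sa a(1)] by blast
    assume "b' \<in> ?h ` \<alpha>"
    then obtain a' where a': "a' \<in> \<alpha>" "b' = ?h a'" by auto
    then have "b + b' = ?h (a + a')" using a \<psi> by (simp add: functional_iff algebra_simps)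
    then show "b + b' \<in> ?h ` \<alpha>" using subspace_add[OF sa a(1) a'(1)] by blast
  qed
  have "w = 0" if "w \<in> x" "w \<in> ?h ` \<alpha>" for w
  proof -
    obtain b where b: "b \<in> \<alpha>" "w = ?h b" using \<open>w \<in> ?h ` \<alpha>\<close> by auto
    have "w - \<psi> b *s v \<in> x"
      using that(1) v by (intro subspace_diff[OF subspace_point] subspace_scale[OF subspace_point])
    then have "b = 0" using b transversal_Int[OF tr] by simp
    then show ?thesis using b functional_zero[OF \<psi>] by simp
  qed
  moreover have "w \<in> {u + b |u b. u \<in> x \<and> b \<in> ?h ` \<alpha>}" for w
  proof -
    obtain u a where ua: "u \<in> x" "a \<in> \<alpha>" "w = u + a" using transversal_decompose[OF tr] by metis
    then have "w = (u - \<psi> a *s v) + ?h a" by simp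
    moreover have "u - \<psi> a *s v \<in> x"
      using ua v by (intro subspace_diff[OF subspace_point] subspace_scale[OF subspace_point])
    ultimately show ?thesis using ua(2) by blast
  qed
  ultimately have tr': "transversal x (?h ` \<alpha>)"
    using subspace_0[OF sub] subspace_0[OF subspace_point] by (auto simp: transversal_def)
  then have "dim (?h ` \<alpha>) = q" using dim_transversal[OF subspace_point sub] dim_point by simp
  with tr' sub show ?thesis by (simp add: complement_def X_minus_def)
qed

text \<open>In the chart of the sheared complement, the line through \<^term>\<open>f\<close> becomes a curve which,
  after rescaling, is affine in the parameter \<open>t / (1 - t \<psi> (f v))\<close>. The difference of two of
  its points is a multiple of the rank one map.\<close>

lemma rank_one_compression:
  assumes \<alpha>: "complement \<alpha>" and f: "f \<in> directions \<alpha>" and \<psi>: "functional \<psi>" and v: "v \<in> x"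
  shows "rank_one (\<lambda>u. \<psi> (f u)) (f v) \<in> directions \<alpha>"
proof -
  define h where "h = (\<lambda>b. b + \<psi> b *s v)"
  define \<beta> where "\<beta> = h ` \<alpha>"
  have \<beta>: "complement \<beta>" unfolding \<beta>_def h_def by (rule complement_shear[OF \<alpha> v \<psi>])
  have fa: "endomorphism f" "\<And>u. u \<in> x \<Longrightarrow> f u \<in> \<alpha>" using f by (auto simp: directions_def)
  define c where "c = \<psi> (f v)"
  \<comment> \<open>From \<open>u + t *s f u = u' + t *s h (f u)\<close> with
    \<open>u' = u - (t * \<psi> (f u)) *s v\<close> one reads off the map in the chart of
    \<open>\<beta>\<close>. Expressing \<open>u\<close> by \<open>u'\<close> gives
    \<open>h (f u) = g s u'\<close> for \<open>s = t / (1 - t * c)\<close>.\<close>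
  define g where "g s u = h (f u) + (s * \<psi> (f u)) *s h (f v)" for s u
  have hb: "h (f u) \<in> \<beta>" if "u \<in> x" for u using fa(2)[OF that] by (simp add: \<beta>_def)
  have g: "g (t / (1 - t * c)) \<in> directions \<beta>" if t: "t \<noteq> 0" "1 - t * c \<noteq> 0" for t
  proof -
    define s where "s = t / (1 - t * c)"
    have st: "s * (1 - t * c) = t" using t by (simp add: s_def)
    have "graph_on x (\<lambda>u. t *s f u) = graph_on x (\<lambda>u. t *s g s u)"
    proof (rule graph_on_reparam[where k = "\<lambda>u. u - (t * \<psi> (f u)) *s v"
          and k' = "\<lambda>u. u + (s * \<psi> (f u)) *s v"])
      fix u assume u: "u \<in> x"
      have "\<psi> (f (u - (t * \<psi> (f u)) *s v)) = \<psi> (f u) * (1 - t * c)"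
        using \<psi> fa(1) by (simp add: functional_diff functional_iff endomorphism_diff endomorphism_iff
            c_def algebra_simps)
      then have "s * \<psi> (f (u - (t * \<psi> (f u)) *s v)) = t * \<psi> (f u)"
        using st by (simp add: ac_simps)
      then have "g s (u - (t * \<psi> (f u)) *s v) = h (f (u - (t * \<psi> (f u)) *s v)) + (t * \<psi> (f u)) *s h (f v)"
        by (simp add: g_def)
      also have "\<dots> = h (f u)"
        using \<psi> fa(1) by (simp add: h_def functional_diff functional_iff endomorphism_diff
            endomorphism_iff algebra_simps)
      finally show "u - (t * \<psi> (f u)) *s v \<in> x \<and>
          u + t *s f u = u - (t * \<psi> (f u)) *s v + t *s g s (u - (t * \<psi> (f u)) *s v)"
        using u v by (auto simp: h_def algebra_simps
            intro!: subspace_diff[OF subspace_point] subspace_scale[OF subspace_point])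
      \<comment> \<open>The relation between \<open>s\<close> and \<open>t\<close> solved for
        \<open>s\<close>; it compares the coefficients of \<open>v\<close> on both sides.\<close>
      have "t * (1 + s * c) = s" using st by (simp add: algebra_simps)
      then have "t * \<psi> (f u) * (1 + s * c) = s * \<psi> (f u)" by (metis mult.assoc mult.commute)
      then have eq: "t * (\<psi> (f u) + s * \<psi> (f u) * c) = s * \<psi> (f u)" by (simp add: algebra_simps)
      have "t *s g s u = t *s f u + (t * (s * \<psi> (f u))) *s f v + (t * (\<psi> (f u) + s * \<psi> (f u) * c)) *s v"
        by (simp add: g_def h_def c_def algebra_simps)
      then have "t *s g s u = t *s f u + (t * (s * \<psi> (f u))) *s f v + (s * \<psi> (f u)) *s v"
        unfolding eq .
      then show "u + (s * \<psi> (f u)) *s v \<in> x \<and>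
          u + t *s g s u = u + (s * \<psi> (f u)) *s v + t *s f (u + (s * \<psi> (f u)) *s v)"
        using u v fa(1) by (auto simp: endomorphism_iff algebra_simps
            intro!: subspace_add[OF subspace_point] subspace_scale[OF subspace_point])
    qed
    moreover have "graph_on x (\<lambda>u. t *s f u) \<in> I"
      using directions_scale[OF \<alpha> f] by (simp add: directions_def)
    moreover have "endomorphism (\<lambda>u. t *s g s u)"
      using fa(1) \<psi> by (auto simp: endomorphism_iff functional_iff g_def h_def algebra_simps)
    moreover have "t *s g s u \<in> \<beta>" if "u \<in> x" for u
      unfolding g_def using hb that v subspace_complement[OF \<beta>]
      by (intro subspace_scale subspace_add)
    ultimately have "(\<lambda>u. t *s g s u) \<in> directions \<beta>" by (simp add: directions_def)
    then have "(\<lambda>u. inverse t *s t *s g s u) \<in> directions \<beta>" by (rule directions_scale[OF \<beta>])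
    then show ?thesis using t by (simp add: s_def)
  qed
  \<comment> \<open>The only pole is at \<open>inverse c\<close>; for \<open>c = 0\<close> this
    value is 0, which is excluded anyway.\<close>
  have avoid: "\<exists>t. t \<notin> T \<and> t \<noteq> 0 \<and> 1 - t * c \<noteq> 0" if "finite T" for T
  proof -
    obtain t where t: "t \<notin> insert 0 (insert (inverse c) T)"
      using infinite_field_avoid[of "insert 0 (insert (inverse c) T)"] \<open>finite T\<close> by auto
    moreover have "1 - t * c \<noteq> 0"
    proof
      assume "1 - t * c = 0"
      then have "t = inverse c" by (metis eq_iff_diff_eq_0 inverse_unique mult.commute)
      with t show False by simp
    qed
    ultimately show ?thesis by blast
  qed
  obtain t1 where t1: "t1 \<noteq> 0" "1 - t1 * c \<noteq> 0" using avoid[of "{}"] by auto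
  obtain t2 where t2: "t2 \<noteq> t1" "t2 \<noteq> 0" "1 - t2 * c \<noteq> 0" using avoid[of "{t1}"] by auto
  define s1 s2 where "s1 = t1 / (1 - t1 * c)" and "s2 = t2 / (1 - t2 * c)"
  \<comment> \<open>After cross-multiplication the terms with \<open>t1 * t2 * c\<close> cancel, so
    equal values would force \<open>t1 = t2\<close>.\<close>
  have "s1 \<noteq> s2"
    using t1 t2 by (simp add: s1_def s2_def frac_eq_eq algebra_simps)
  have "(\<lambda>u. inverse (s1 - s2) *s g s1 u + (- inverse (s1 - s2)) *s g s2 u) \<in> directions \<beta>"
    using g[OF t1] g[OF t2(2,3)] unfolding s1_def s2_def by (rule directions_lincomb[OF \<beta>])
  also have "(\<lambda>u. inverse (s1 - s2) *s g s1 u + (- inverse (s1 - s2)) *s g s2 u) =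
      rank_one (\<lambda>u. \<psi> (f u)) (h (f v))"
  proof
    fix u
    have "inverse (s1 - s2) *s g s1 u + (- inverse (s1 - s2)) *s g s2 u =
        inverse (s1 - s2) *s (g s1 u - g s2 u)"
      by (simp add: scale_right_diff_distrib)
    also have "g s1 u - g s2 u = ((s1 - s2) * \<psi> (f u)) *s h (f v)"
      by (simp add: g_def algebra_simps)
    finally show "inverse (s1 - s2) *s g s1 u + (- inverse (s1 - s2)) *s g s2 u =
        \<psi> (f u) *s h (f v)"
      using \<open>s1 \<noteq> s2\<close> by simp
  qed
  finally have "rank_one (\<lambda>u. \<psi> (f u)) (h (f v)) \<in> directions \<beta>" .
  \<comment> \<open>The shear moves \<open>f v\<close> only within its class modulo
    \<open>x\<close>, so \<open>rank_one_transfer\<close> leads back from \<open>\<beta>\<close> to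
    \<open>\<alpha>\<close>.\<close>
  moreover have "f v - h (f v) \<in> x"
    using v by (simp add: h_def subspace_neg[OF subspace_point] subspace_scale[OF subspace_point])
  moreover have "functional (\<lambda>u. \<psi> (f u))"
    using \<psi> fa(1) by (simp add: functional_iff endomorphism_iff)
  ultimately show ?thesis
    using rank_one_transfer[OF \<beta> \<alpha> hb[OF v] fa(2)[OF v]] by simp
qed

text \<open>Polarization: compressing the sum of the two maps by a functional with value 1 at
  \<open>a\<close> and 0 at \<open>b\<close>, at a vector \<open>v\<close> with
  \<open>\<phi> v = 0\<close> and \<open>\<chi> v \<noteq> 0\<close>, leaves a nonzero multiple of
  the mixed map. If no such functional or vector exists, then \<open>b\<close> is a multiple of
  \<open>a\<close>, or \<open>\<phi>\<close> is a multiple of \<open>\<chi>\<close> on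
  \<open>x\<close>.\<close>

lemma rank_one_exchange:
  assumes \<alpha>: "complement \<alpha>" and \<phi>: "functional \<phi>" and \<chi>: "functional \<chi>"
    and \<phi>a: "rank_one \<phi> a \<in> directions \<alpha>" and \<chi>b: "rank_one \<chi> b \<in> directions \<alpha>"
    and a: "a \<noteq> 0" and \<chi>0: "\<exists>u\<in>x. \<chi> u \<noteq> 0"
  shows "rank_one \<phi> b \<in> directions \<alpha>"
proof (cases "\<exists>s. b = s *s a")
  case True
  then obtain s where "b = s *s a" by blast
  then show ?thesis using directions_scale[OF \<alpha> \<phi>a, of s] by (simp add: mult.commute)
next
  case indep: False
  show ?thesis
  proof (cases "\<exists>v\<in>x. \<phi> v = 0 \<and> \<chi> v \<noteq> 0")
    case True
    then obtain v where v: "v \<in> x" "\<phi> v = 0" "\<chi> v \<noteq> 0" by blast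
    have "a \<notin> span {b}"
    proof
      assume "a \<in> span {b}"
      then obtain k where "a = k *s b" by (auto simp: span_singleton)
      with a have "b = inverse k *s a" by auto
      with indep show False by blast
    qed
    then obtain \<psi> where \<psi>: "functional \<psi>" "\<psi> a = 1" "\<And>u. u \<in> span {b} \<Longrightarrow> \<psi> u = 0"
      using functional_separating[OF subspace_span] by metis
    have b0: "\<psi> b = 0" using \<psi>(3) by (simp add: span_base)
    let ?f = "\<lambda>u. 1 *s (\<phi> u *s a) + 1 *s (\<chi> u *s b)"
    have "?f \<in> directions \<alpha>" by (rule directions_lincomb[OF \<alpha> \<phi>a \<chi>b])
    \<comment> \<open>Here \<open>\<psi> (?f u) = \<phi> u\<close>, and
      \<open>?f v = \<chi> v *s b\<close> because \<open>\<phi> v = 0\<close>.\<close>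
    from rank_one_compression[OF \<alpha> this \<psi>(1) v(1)]
    have "rank_one \<phi> (\<chi> v *s b) \<in> directions \<alpha>"
      using \<psi>(1,2) b0 v(2) by (simp add: functional_iff)
    from directions_scale[OF \<alpha> this, of "inverse (\<chi> v)"] v(3) show ?thesis
      by (simp add: field_simps)
  next
    case False
    \<comment> \<open>On \<open>x\<close> the kernel of \<open>\<phi>\<close> is contained in that
      of \<open>\<chi>\<close>; as \<open>\<chi>\<close> is nonzero there, the two are
      proportional.\<close>
    obtain w where w: "w \<in> x" "\<chi> w \<noteq> 0" using \<chi>0 by blast
    then have \<phi>w: "\<phi> w \<noteq> 0" using False by blast
    have "\<phi> u = (\<phi> w / \<chi> w) * \<chi> u" if u: "u \<in> x" for u
    proof -
      have "u - (\<phi> u / \<phi> w) *s w \<in> x"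
        using u w by (intro subspace_diff[OF subspace_point] subspace_scale[OF subspace_point])
      moreover have "\<phi> (u - (\<phi> u / \<phi> w) *s w) = 0"
        using \<phi> \<phi>w by (simp add: functional_diff functional_iff)
      ultimately have "\<chi> (u - (\<phi> u / \<phi> w) *s w) = 0" using False by blast
      then have "\<chi> u = (\<phi> u / \<phi> w) * \<chi> w" using \<chi> by (simp add: functional_diff functional_iff)
      then show ?thesis using w \<phi>w by simp
    qed
    then show ?thesis
      using directions_scale[OF \<alpha> \<chi>b, of "\<phi> w / \<chi> w"] endomorphism_rank_one[OF \<phi>]
      by (auto intro: directions_cong)
  qed
qed

section \<open>The flag determined by the rank one directions\<close>

text \<open>The condition \<open>a \<noteq> 0\<close> discards the zero map, for which
  \<open>\<phi>\<close> would be arbitrary. In \<open>flag_top\<close> the nonvanishing of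
  \<open>\<phi>\<close> on \<open>x\<close> does the same for \<open>a\<close>.\<close>

definition flag_bottom :: "'m set \<Rightarrow> 'm set" where
  "flag_bottom \<alpha> =
    {u \<in> x. \<forall>\<phi> a. functional \<phi> \<and> a \<noteq> 0 \<and> rank_one \<phi> a \<in> directions \<alpha> \<longrightarrow> \<phi> u = 0}"

definition flag_top :: "'m set \<Rightarrow> 'm set" where
  "flag_top \<alpha> =
    span (x \<union> {a. \<exists>\<phi>. functional \<phi> \<and> (\<exists>u\<in>x. \<phi> u \<noteq> 0) \<and> rank_one \<phi> a \<in> directions \<alpha>})"

lemma subspace_flag_bottom: "subspace (flag_bottom \<alpha>)"
proof (rule subspaceI)
  show "0 \<in> flag_bottom \<alpha>"
    using subspace_0[OF subspace_point] functional_zero unfolding flag_bottom_def by blast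
  fix u v c assume u: "u \<in> flag_bottom \<alpha>"
  show "c *s u \<in> flag_bottom \<alpha>"
    using u subspace_scale[OF subspace_point] unfolding flag_bottom_def
    by (auto simp: functional_scale)
  assume v: "v \<in> flag_bottom \<alpha>"
  have "\<phi> (u + v) = 0" if "functional \<phi>" "a \<noteq> 0" "rank_one \<phi> a \<in> directions \<alpha>" for \<phi> a
  proof -
    have "\<phi> u = 0" "\<phi> v = 0" using that u v unfolding flag_bottom_def by blast+
    then show ?thesis using that(1) by (simp add: functional_add)
  qed
  then show "u + v \<in> flag_bottom \<alpha>"
    using u v subspace_add[OF subspace_point] unfolding flag_bottom_def by blast
qed

lemma flag_bottom_subset: "flag_bottom \<alpha> \<subseteq> x"
  by (auto simp: flag_bottom_def)

lemma flag_top_superset: "x \<subseteq> flag_top \<alpha>"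
  by (auto simp: flag_top_def intro: span_base)

lemma subspace_flag_top: "subspace (flag_top \<alpha>)"
  by (simp add: flag_top_def)

lemma rank_one_direction_mem:
  assumes "complement \<alpha>" "rank_one \<phi> a \<in> directions \<alpha>" "u \<in> x" "\<phi> u \<noteq> 0"
  shows "a \<in> \<alpha>"
proof -
  have "\<phi> u *s a \<in> \<alpha>" using assms by (simp add: directions_def)
  then have "inverse (\<phi> u) *s \<phi> u *s a \<in> \<alpha>"
    by (rule subspace_scale[OF subspace_complement[OF assms(1)]])
  with assms(4) show ?thesis by simp
qed

text \<open>Split \<open>a\<close> along \<open>x\<close> and \<open>\<beta>\<close> and transfer.
  The new value \<open>b\<close> cannot vanish for nonzero \<open>a\<close>, since \<open>a\<close>
  would then lie in both \<open>x\<close> and \<open>\<alpha>\<close>.\<close>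

lemma rank_one_direction_change:
  assumes \<alpha>: "complement \<alpha>" and \<beta>: "complement \<beta>" and \<phi>: "functional \<phi>"
    and dir: "rank_one \<phi> a \<in> directions \<alpha>" and u: "u \<in> x" "\<phi> u \<noteq> 0"
  obtains w b where "w \<in> x" "a = w + b" "rank_one \<phi> b \<in> directions \<beta>" "a \<noteq> 0 \<Longrightarrow> b \<noteq> 0"
proof -
  have a: "a \<in> \<alpha>" by (rule rank_one_direction_mem[OF \<alpha> dir u])
  have tr: "transversal x \<alpha>" "transversal x \<beta>" using \<alpha> \<beta> by (auto simp: complement_def)
  obtain w b where wb: "w \<in> x" "b \<in> \<beta>" "a = w + b"
    using transversal_decompose[OF tr(2)] by metis
  have "b - a \<in> x" using wb subspace_neg[OF subspace_point] by simp
  then have "rank_one \<phi> b \<in> directions \<beta>" by (rule rank_one_transfer[OF \<alpha> \<beta> a wb(2) _ \<phi> dir])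
  moreover have "b \<noteq> 0" if "a \<noteq> 0" using that wb a transversal_Int[OF tr(1)] by auto
  ultimately show thesis using that wb by blast
qed

text \<open>A functional of a nonzero rank one direction that does not vanish at \<open>u\<close>
  also occurs for the other complement. Exchanging the complements gives equality.\<close>

lemma flag_bottom_mono:
  assumes \<alpha>: "complement \<alpha>" and \<beta>: "complement \<beta>"
  shows "flag_bottom \<beta> \<subseteq> flag_bottom \<alpha>"
proof
  fix u assume u: "u \<in> flag_bottom \<beta>"
  then have ux: "u \<in> x" using flag_bottom_subset by blast
  have "\<phi> u = 0" if \<phi>: "functional \<phi>" "a \<noteq> 0" "rank_one \<phi> a \<in> directions \<alpha>" for \<phi> a
  proof (rule ccontr)
    assume "\<phi> u \<noteq> 0"
    then obtain w b where "rank_one \<phi> b \<in> directions \<beta>" "b \<noteq> 0"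
      using rank_one_direction_change[OF \<alpha> \<beta> \<phi>(1,3) ux] \<phi>(2) by metis
    with u \<phi> \<open>\<phi> u \<noteq> 0\<close> show False unfolding flag_bottom_def by blast
  qed
  with ux show "u \<in> flag_bottom \<alpha>" by (auto simp: flag_bottom_def)
qed

text \<open>Changing the complement alters the value of a rank one direction only by a vector of
  \<open>x\<close>, which lies in \<open>flag_top \<beta>\<close>.\<close>

lemma flag_top_mono:
  assumes \<alpha>: "complement \<alpha>" and \<beta>: "complement \<beta>"
  shows "flag_top \<alpha> \<subseteq> flag_top \<beta>"
  unfolding flag_top_def[of \<alpha>]
proof (rule span_minimal[OF _ subspace_flag_top], safe)
  show "u \<in> flag_top \<beta>" if "u \<in> x" for u using that flag_top_superset by blast
  fix a \<phi> u assume \<phi>: "functional \<phi>" "rank_one \<phi> a \<in> directions \<alpha>" "u \<in> x" "\<phi> u \<noteq> 0"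
  then obtain w b where wb: "w \<in> x" "a = w + b" "rank_one \<phi> b \<in> directions \<beta>"
    using rank_one_direction_change[OF \<alpha> \<beta>] by metis
  then have "b \<in> flag_top \<beta>" using \<phi> unfolding flag_top_def by (intro span_base) blast
  then show "a \<in> flag_top \<beta>"
    using wb flag_top_superset subspace_add[OF subspace_flag_top] by blast
qed

text \<open>The admissible values for the fixed functional \<open>\<chi>\<close> form a subspace. By
  \<open>rank_one_exchange\<close> its sum with \<open>x\<close> contains all generators of
  \<open>flag_top \<alpha>\<close>, and for \<open>b \<in> \<alpha>\<close> the component in
  \<open>x\<close> vanishes.\<close>

lemma rank_one_flag_top:
  assumes \<alpha>: "complement \<alpha>" and \<chi>: "functional \<chi>" "rank_one \<chi> a \<in> directions \<alpha>" "a \<noteq> 0"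
    and b: "b \<in> flag_top \<alpha>" "b \<in> \<alpha>"
  shows "rank_one \<chi> b \<in> directions \<alpha>"
proof -
  let ?S = "{w + c |w c. w \<in> x \<and> c \<in> {c \<in> \<alpha>. rank_one \<chi> c \<in> directions \<alpha>}}"
  note sa = subspace_complement[OF \<alpha>]
  have sub: "subspace {c \<in> \<alpha>. rank_one \<chi> c \<in> directions \<alpha>}"
  proof (rule subspaceI, goal_cases)
    case 1
    show ?case using subspace_0[OF sa] directions_zero[OF \<alpha> endomorphism_rank_one[OF \<chi>(1), of 0]] by simp
  next
    case (2 c d)
    then show ?case using directions_lincomb[OF \<alpha>, of "rank_one \<chi> c" "rank_one \<chi> d" 1 1]
      by (auto simp: scale_right_distrib intro: subspace_add[OF sa])
  next
    case (3 k c)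
    then show ?case using directions_scale[OF \<alpha>, of "rank_one \<chi> c" k]
      by (auto simp: mult.commute intro: subspace_scale[OF sa])
  qed
  have "flag_top \<alpha> \<subseteq> ?S"
    unfolding flag_top_def
  proof (rule span_minimal[OF _ subspace_sums[OF subspace_point sub]], safe)
    show "\<exists>w c. u = w + c \<and> w \<in> x \<and> c \<in> {c \<in> \<alpha>. rank_one \<chi> c \<in> directions \<alpha>}" if "u \<in> x" for u
      using that subspace_0[OF sub] by force
    fix c \<phi> u assume \<phi>: "functional \<phi>" "rank_one \<phi> c \<in> directions \<alpha>" "u \<in> x" "\<phi> u \<noteq> 0"
    then have "rank_one \<chi> c \<in> directions \<alpha>" using rank_one_exchange[OF \<alpha> \<chi>(1) _ \<chi>(2) _ \<chi>(3)] by blast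
    then show "\<exists>w d. c = w + d \<and> w \<in> x \<and> d \<in> {c \<in> \<alpha>. rank_one \<chi> c \<in> directions \<alpha>}"
      using subspace_0[OF subspace_point] rank_one_direction_mem[OF \<alpha> \<phi>(2-4)] by force
  qed
  then obtain w c where wc: "w \<in> x" "c \<in> \<alpha>" "rank_one \<chi> c \<in> directions \<alpha>" "b = w + c"
    using b(1) by blast
  have "w \<in> \<alpha>" using subspace_diff[OF sa b(2) wc(2)] wc(4) by simp
  then have "w = 0" using wc(1) \<alpha> transversal_Int unfolding complement_def by blast
  with wc show ?thesis by simp
qed

text \<open>If \<open>f u \<noteq> 0\<close>, compression by a functional with value 1 at
  \<open>f u\<close> yields a rank one direction with value \<open>f u\<close> that does not kill
  \<open>u\<close>. Conversely, a map satisfying the two conditions is reduced to zero on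
  \<open>x\<close> by subtracting rank one directions.\<close>

lemma directions_iff:
  assumes \<alpha>: "complement \<alpha>" and f: "endomorphism f" "\<And>u. u \<in> x \<Longrightarrow> f u \<in> \<alpha>"
  shows "f \<in> directions \<alpha> \<longleftrightarrow> (\<forall>u\<in>flag_bottom \<alpha>. f u = 0) \<and> (\<forall>u\<in>x. f u \<in> flag_top \<alpha>)"
    (is "_ \<longleftrightarrow> ?R f")
proof
  assume dir: "f \<in> directions \<alpha>"
  have compress: "\<exists>\<psi>. functional \<psi> \<and> \<psi> (f u) = 1 \<and> functional (\<lambda>u. \<psi> (f u)) \<and>
      rank_one (\<lambda>u. \<psi> (f u)) (f u) \<in> directions \<alpha>" if "u \<in> x" "f u \<noteq> 0" for u
  proof -
    obtain \<psi> where \<psi>: "functional \<psi>" "\<psi> (f u) = 1"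
      using functional_separating[OF subspace_single_0, of "f u"] \<open>f u \<noteq> 0\<close> by blast
    have "functional (\<lambda>u. \<psi> (f u))" using \<psi>(1) f(1) by (simp add: functional_iff endomorphism_iff)
    with \<psi> show ?thesis using rank_one_compression[OF \<alpha> dir \<psi>(1) that(1)] by blast
  qed
  have "f u = 0" if u: "u \<in> flag_bottom \<alpha>" for u
  proof (rule ccontr)
    assume "f u \<noteq> 0"
    moreover have "u \<in> x" using u flag_bottom_subset by blast
    ultimately obtain \<psi> where \<psi>: "\<psi> (f u) = 1" "functional (\<lambda>u. \<psi> (f u))"
      "rank_one (\<lambda>u. \<psi> (f u)) (f u) \<in> directions \<alpha>" using compress by blast
    then have "\<psi> (f u) = 0" using u \<open>f u \<noteq> 0\<close> unfolding flag_bottom_def by blast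
    with \<psi>(1) show False by simp
  qed
  moreover have "f u \<in> flag_top \<alpha>" if u: "u \<in> x" for u
  proof (cases "f u = 0")
    case True
    then show ?thesis using subspace_0[OF subspace_flag_top] by simp
  next
    case False
    then obtain \<psi> where \<psi>: "\<psi> (f u) = 1" "functional (\<lambda>u. \<psi> (f u))"
      "rank_one (\<lambda>u. \<psi> (f u)) (f u) \<in> directions \<alpha>" using compress[OF u] by blast
    then have "\<exists>v\<in>x. \<psi> (f v) \<noteq> 0" using u by force
    then show ?thesis
      unfolding flag_top_def using \<psi>(2,3) by (intro span_base) blast
  qed
  ultimately show "?R f" by blast
next
  assume R: "?R f"
  \<comment> \<open>Candidates between \<open>flag_bottom \<alpha>\<close> and \<open>x\<close> such
    that vanishing on \<open>K\<close> suffices for being a direction. Starting from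
    \<open>x\<close>, a candidate of least dimension turns out to be
    \<open>flag_bottom \<alpha>\<close>.\<close>
  define ok where "ok K \<longleftrightarrow> subspace K \<and> flag_bottom \<alpha> \<subseteq> K \<and> K \<subseteq> x \<and>
    (\<forall>g. endomorphism g \<and> (\<forall>u\<in>x. g u \<in> \<alpha> \<inter> flag_top \<alpha>) \<and> (\<forall>u\<in>K. g u = 0) \<longrightarrow> g \<in> directions \<alpha>)" for K
  have "ok x"
    using directions_zero[OF \<alpha>] subspace_point flag_bottom_subset by (auto simp: ok_def)
  then obtain K where K: "ok K" and minimal: "\<And>L. ok L \<Longrightarrow> dim K \<le> dim L"
    using ex_has_least_nat[of ok x dim] by blast
  have "K \<subseteq> flag_bottom \<alpha>"
  proof (rule ccontr)
    assume "\<not> ?thesis"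
    then obtain v where "v \<in> K" "v \<notin> flag_bottom \<alpha>" by blast
    then obtain \<chi> a where \<chi>: "functional \<chi>" "a \<noteq> 0" "rank_one \<chi> a \<in> directions \<alpha>" "\<chi> v \<noteq> 0"
      using K unfolding flag_bottom_def ok_def by blast
    define w where "w = inverse (\<chi> v) *s v"
    have w: "w \<in> K" "\<chi> w = 1" "w \<in> x"
      using \<chi>(1,4) K \<open>v \<in> K\<close> subspace_scale by (auto simp: w_def ok_def functional_iff)
    let ?L = "{u \<in> K. \<chi> u = 0}"
    have "ok ?L"
      unfolding ok_def
    proof (intro conjI allI impI)
      show "subspace ?L"
        using K \<chi>(1) by (auto simp: ok_def functional_zero functional_iff subspace_def)
      show "flag_bottom \<alpha> \<subseteq> ?L"
        using K \<chi> by (auto simp: ok_def flag_bottom_def)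
      show "?L \<subseteq> x" using K by (auto simp: ok_def)
      fix g assume g: "endomorphism g \<and> (\<forall>u\<in>x. g u \<in> \<alpha> \<inter> flag_top \<alpha>) \<and> (\<forall>u\<in>?L. g u = 0)"
      have rk: "rank_one \<chi> (g w) \<in> directions \<alpha>"
        using rank_one_flag_top[OF \<alpha> \<chi>(1,3,2)] g w(3) by blast
      \<comment> \<open>As \<open>\<chi> w = 1\<close>, \<open>K\<close> is spanned by
        \<open>?L\<close> and \<open>w\<close>. The map \<open>k\<close> vanishes on both, so it is
        a direction by the property of \<open>K\<close>, and adding the rank one direction
        \<open>rk\<close> recovers \<open>g\<close>.\<close>
      define k where "k u = g u - \<chi> u *s g w" for u
      have "endomorphism k"
        using g \<chi>(1) by (auto simp: endomorphism_iff functional_iff k_def algebra_simps)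
      moreover have "k u \<in> \<alpha> \<inter> flag_top \<alpha>" if "u \<in> x" for u
        unfolding k_def
        using that w(3) g subspace_complement[OF \<alpha>] subspace_flag_top[of \<alpha>]
        by (intro IntI subspace_diff subspace_scale) auto
      moreover have "k u = 0" if u: "u \<in> K" for u
      proof -
        have "u - \<chi> u *s w \<in> ?L"
          using K \<chi>(1) u w by (auto simp: ok_def functional_diff functional_iff
              intro: subspace_diff subspace_scale)
        then have "g (u - \<chi> u *s w) = 0" using g by blast
        then show ?thesis using g by (simp add: k_def endomorphism_diff endomorphism_iff)
      qed
      ultimately have "k \<in> directions \<alpha>" using K unfolding ok_def by blast
      from directions_lincomb[OF \<alpha> this rk, of 1 1] show "g \<in> directions \<alpha>" by (simp add: k_def)
    qed
    moreover have "dim ?L < dim K"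
    proof (rule dim_psubset)
      have "subspace ?L" "subspace K" using \<open>ok ?L\<close> K by (auto simp: ok_def)
      then have "span ?L = ?L" "span K = K" by (simp_all only: span_eq_iff)
      moreover have "w \<notin> ?L" using w(2) by simp
      then have "?L \<subset> K" using w(1) by blast
      ultimately show "span ?L \<subset> span K" by (simp only:)
    qed
    ultimately show False using minimal by (metis leD)
  qed
  then show "f \<in> directions \<alpha>" using K R f unfolding ok_def by blast
qed

text \<open>A common complement writes any \<open>y\<close> as a graph over \<open>x\<close>. Then
  \<open>y\<close> contains \<open>flag_bottom\<close> exactly when the map vanishes there, and lies
  in \<open>flag_top\<close> exactly when the values do.\<close>

lemma intrinsic_eq_flag_subspace:
  obtains e1 e2 where "subspace e1" "subspace e2" "e1 \<subseteq> x" "x \<subseteq> e2" "I = flag_subspace e1 e2"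
proof -
  obtain \<alpha>0 where \<alpha>0: "complement \<alpha>0"
    using common_complement[OF point_X_plus point_X_plus] by (auto simp: complement_def)
  have "y \<in> I \<longleftrightarrow> flag_bottom \<alpha>0 \<subseteq> y \<and> y \<subseteq> flag_top \<alpha>0" if y: "y \<in> X_plus" for y
  proof -
    obtain \<alpha> where \<alpha>: "\<alpha> \<in> X_minus" "transversal x \<alpha>" "transversal y \<alpha>"
      using common_complement[OF point_X_plus y] by blast
    then have compl: "complement \<alpha>" by (simp add: complement_def)
    \<comment> \<open>The complement varies with \<open>y\<close>; the flag does not.\<close>
    have eq: "flag_bottom \<alpha>0 = flag_bottom \<alpha>" "flag_top \<alpha>0 = flag_top \<alpha>"
      by (intro equalityI flag_bottom_mono flag_top_mono \<alpha>0 compl)+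
    have sy: "subspace y" using y by (simp add: X_plus_def)
    obtain f where f: "endomorphism f" "\<And>u. f u \<in> \<alpha>" "graph_on x f = y"
      using chart_graph[OF subspace_point sy subspace_complement[OF compl] \<alpha>(2,3)] by blast
    have "y \<in> I \<longleftrightarrow> f \<in> directions \<alpha>" using f by (simp add: directions_def)
    also have "\<dots> \<longleftrightarrow> (\<forall>u\<in>flag_bottom \<alpha>. f u = 0) \<and> (\<forall>u\<in>x. f u \<in> flag_top \<alpha>)"
      using f by (intro directions_iff compl) auto
    also have "(\<forall>u\<in>flag_bottom \<alpha>. f u = 0) \<longleftrightarrow> flag_bottom \<alpha> \<subseteq> y"
    proof
      assume z: "\<forall>u\<in>flag_bottom \<alpha>. f u = 0"
      have "u \<in> graph_on x f" if "u \<in> flag_bottom \<alpha>" for u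
        using that z flag_bottom_subset[of \<alpha>] unfolding graph_on_def by force
      then show "flag_bottom \<alpha> \<subseteq> y" using f(3) by blast
    next
      assume sub: "flag_bottom \<alpha> \<subseteq> y"
      show "\<forall>u\<in>flag_bottom \<alpha>. f u = 0"
      proof
        fix u assume u: "u \<in> flag_bottom \<alpha>"
        then have "u \<in> graph_on x f" using sub f(3) by blast
        then obtain u' where u': "u' \<in> x" "u = u' + f u'" by (auto simp: graph_on_def)
        \<comment> \<open>This vector lies in \<open>x\<close> as well as in
          \<open>\<alpha>\<close>, hence is zero.\<close>
        have "f u' = u - u'" using u'(2) by simp
        also have "\<dots> \<in> x" using u u' flag_bottom_subset by (intro subspace_diff[OF subspace_point]) auto
        finally have "f u' = 0" using f(2) transversal_Int[OF \<alpha>(2)] by blast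
        with u' show "f u = 0" by simp
      qed
    qed
    also have "(\<forall>u\<in>x. f u \<in> flag_top \<alpha>) \<longleftrightarrow> y \<subseteq> flag_top \<alpha>"
    proof
      assume "\<forall>u\<in>x. f u \<in> flag_top \<alpha>"
      then have "graph_on x f \<subseteq> flag_top \<alpha>"
        using flag_top_superset[of \<alpha>] subspace_add[OF subspace_flag_top] by (auto simp: graph_on_def)
      then show "y \<subseteq> flag_top \<alpha>" using f(3) by simp
    next
      assume sub: "y \<subseteq> flag_top \<alpha>"
      show "\<forall>u\<in>x. f u \<in> flag_top \<alpha>"
      proof
        fix u assume u: "u \<in> x"
        then have "u + f u \<in> flag_top \<alpha>" using sub f(3) by (auto simp: graph_on_def)
        then have "(u + f u) - u \<in> flag_top \<alpha>"
          using u flag_top_superset by (intro subspace_diff[OF subspace_flag_top]) auto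
        then show "f u \<in> flag_top \<alpha>" by simp
      qed
    qed
    finally show ?thesis by (simp add: eq)
  qed
  then have "I = flag_subspace (flag_bottom \<alpha>0) (flag_top \<alpha>0)"
    using intrinsic by (auto simp: flag_subspace_def intrinsic_subspace_def)
  then show thesis
    using that subspace_flag_bottom subspace_flag_top flag_bottom_subset flag_top_superset by blast
qed

end

section \<open>Flag subspaces are intrinsic; joins and principal subspaces\<close>

context grassmannian_geometry
begin

text \<open>In a chart with origin \<open>x\<close> the two inclusions become linear conditions on
  the map: it vanishes on \<open>e1\<close> and has values in \<open>e2\<close>.\<close>

lemma flag_subspace_intrinsic:
  assumes "subspace e2"
  shows "intrinsic_subspace (flag_subspace e1 e2)"
  unfolding intrinsic_subspace_def
proof (intro conjI ballI)
  show "flag_subspace e1 e2 \<subseteq> X_plus" by (auto simp: flag_subspace_def)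
  fix \<alpha> x assume \<alpha>: "\<alpha> \<in> X_minus" and "x \<in> affine_chart \<alpha> \<inter> flag_subspace e1 e2"
  then have x: "x \<in> X_plus" "transversal x \<alpha>" "e1 \<subseteq> x" "x \<subseteq> e2"
    by (auto simp: affine_chart_def flag_subspace_def)
  have sub: "subspace x" "subspace \<alpha>" using x \<alpha> by (auto simp: X_plus_def X_minus_def)
  define F where "F = {f \<in> hom_on x \<alpha>. (\<forall>u\<in>e1. f u = 0) \<and> (\<forall>u\<in>x. f u \<in> e2)}"
  have "module.subspace (\<lambda>c f u. c *s f u) F"
    unfolding module.subspace_def[OF module_maps]
    using subspace_0[OF sub(2)] subspace_add[OF sub(2)] subspace_scale[OF sub(2)]
      subspace_0[OF assms] subspace_add[OF assms] subspace_scale[OF assms]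
    by (auto simp: F_def hom_on_def algebra_simps)
  moreover have "affine_chart \<alpha> \<inter> flag_subspace e1 e2 = graph_on x ` F"
  proof
    show "graph_on x ` F \<subseteq> affine_chart \<alpha> \<inter> flag_subspace e1 e2"
    proof
      fix y assume "y \<in> graph_on x ` F"
      then obtain f where f: "f \<in> F" "y = graph_on x f" by blast
      then have y: "y \<in> affine_chart \<alpha>" using graph_in_chart[OF x(1) \<alpha> x(2)] by (auto simp: F_def)
      have "e1 \<subseteq> y" using f x(3) by (force simp: F_def graph_on_def)
      moreover have "y \<subseteq> e2" using f x(4) subspace_add[OF assms] by (auto simp: F_def graph_on_def)
      ultimately show "y \<in> affine_chart \<alpha> \<inter> flag_subspace e1 e2"
        using y by (auto simp: flag_subspace_def affine_chart_def)
    qed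
    show "affine_chart \<alpha> \<inter> flag_subspace e1 e2 \<subseteq> graph_on x ` F"
    proof
      fix y assume "y \<in> affine_chart \<alpha> \<inter> flag_subspace e1 e2"
      then have y: "subspace y" "transversal y \<alpha>" "e1 \<subseteq> y" "y \<subseteq> e2"
        by (auto simp: affine_chart_def flag_subspace_def X_plus_def)
      obtain f where f: "endomorphism f" "\<And>u. f u \<in> \<alpha>" "graph_on x f = y"
        using chart_graph[OF sub(1) y(1) sub(2) x(2) y(2)] by blast
      define g where "g u = (if u \<in> x then f u else 0)" for u
      have gy: "graph_on x g = y" using f(3) by (metis g_def graph_on_cong)
      have "g \<in> hom_on x \<alpha>"
        using f(1,2) subspace_add[OF sub(1)] subspace_scale[OF sub(1)]
        by (auto simp: hom_on_def g_def endomorphism_iff)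
      moreover have "g u = 0" if u: "u \<in> e1" for u
      proof -
        obtain v where v: "v \<in> x" "u = v + f v" using u y(3) f(3) by (auto simp: graph_on_def)
        have "f v = u - v" using v(2) by simp
        also have "\<dots> \<in> x" using u v x(3) by (intro subspace_diff[OF sub(1)]) auto
        finally have "f v = 0" using f(2) transversal_Int[OF x(2)] by blast
        with v show ?thesis by (simp add: g_def)
      qed
      moreover have "g u \<in> e2" if u: "u \<in> x" for u
      proof -
        have "u + f u \<in> e2" using u y(4) f(3) by (auto simp: graph_on_def)
        then have "(u + f u) - u \<in> e2" using u x(4) by (intro subspace_diff[OF assms]) auto
        with u show ?thesis by (simp add: g_def)
      qed
      ultimately have "g \<in> F" by (simp add: F_def)
      with gy show "y \<in> graph_on x ` F" by blast
    qed
  qed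
  ultimately show "chart_subspace \<alpha> x (affine_chart \<alpha> \<inter> flag_subspace e1 e2)"
    unfolding chart_subspace_def by (intro exI[of _ F]) (auto simp: F_def)
qed

lemma intrinsic_subspace_cases:
  assumes "infinite (UNIV :: 'k set)" "intrinsic_subspace I" "x \<in> I"
  obtains e1 e2 where "subspace e1" "subspace e2" "e1 \<subseteq> x" "x \<subseteq> e2" "I = flag_subspace e1 e2"
proof -
  interpret pointed_intrinsic_subspace scale Basis p q I x
    using assms by unfold_locales
  show thesis using intrinsic_eq_flag_subspace that by blast
qed

lemma subset_sums:
  assumes "subspace S" "subspace T"
  shows "S \<subseteq> {u + v |u v. u \<in> S \<and> v \<in> T}" "T \<subseteq> {u + v |u v. u \<in> S \<and> v \<in> T}"
proof -
  have "u = u + 0" "u = 0 + u" for u :: 'm by simp_all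
  then show "S \<subseteq> {u + v |u v. u \<in> S \<and> v \<in> T}" "T \<subseteq> {u + v |u v. u \<in> S \<and> v \<in> T}"
    using subspace_0[OF assms(1)] subspace_0[OF assms(2)] by blast+
qed

text \<open>The flag subspace on the right is intrinsic and contains both points. Conversely, an
  intrinsic subspace containing both is a flag subspace by the classification, with bottom inside
  the intersection and top containing the sum.\<close>

lemma intrinsic_join_eq:
  assumes inf: "infinite (UNIV :: 'k set)" and x: "x \<in> X_plus" and y: "y \<in> X_plus"
  shows "intrinsic_join x y = flag_subspace (x \<inter> y) {u + v |u v. u \<in> x \<and> v \<in> y}"
    (is "_ = flag_subspace _ ?S")
proof
  have sub: "subspace x" "subspace y" using x y by (auto simp: X_plus_def)
  have "x \<subseteq> ?S" "y \<subseteq> ?S" using subset_sums sub by blast+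
  then have "x \<in> flag_subspace (x \<inter> y) ?S" "y \<in> flag_subspace (x \<inter> y) ?S"
    using x y by (auto simp: flag_subspace_def)
  then show "intrinsic_join x y \<subseteq> flag_subspace (x \<inter> y) ?S"
    using flag_subspace_intrinsic[OF subspace_sums[OF sub]] by (auto simp: intrinsic_join_def)
  have "flag_subspace (x \<inter> y) ?S \<subseteq> J" if J: "intrinsic_subspace J" "x \<in> J" "y \<in> J" for J
  proof -
    obtain e1 e2 where e: "subspace e2" "J = flag_subspace e1 e2"
      using intrinsic_subspace_cases[OF inf J(1,2)] by metis
    then have "e1 \<subseteq> x \<inter> y" "x \<subseteq> e2" "y \<subseteq> e2" using J by (auto simp: flag_subspace_def)
    moreover from this have "?S \<subseteq> e2" using subspace_add[OF e(1)] by blast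
    ultimately show ?thesis using e(2) unfolding flag_subspace_def by blast
  qed
  then show "flag_subspace (x \<inter> y) ?S \<subseteq> intrinsic_join x y" by (auto simp: intrinsic_join_def)
qed

text \<open>By the dimension formula the intersection has dimension (|A| + |B|) + (|A| + |C|) - (|A|
  + |B| + |C|) = |A|.\<close>

lemma span_Un_Int_independent:
  assumes "independent (A \<union> B \<union> C)" "A \<inter> B = {}" "A \<inter> C = {}" "B \<inter> C = {}"
  shows "span (A \<union> B) \<inter> span (A \<union> C) = span A"
proof (rule subspace_dim_equal[symmetric])
  show "subspace (span A)" "subspace (span (A \<union> B) \<inter> span (A \<union> C))"
    by (auto intro: subspace_inter)
  show "span A \<subseteq> span (A \<union> B) \<inter> span (A \<union> C)" by (simp add: span_mono)
  have ind: "independent A" "independent (A \<union> B)" "independent (A \<union> C)"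
    by (rule independent_mono[OF assms(1)], blast)+
  have fin: "finite A" "finite B" "finite C"
    using finiteI_independent[OF assms(1)] by auto
  have "span (A \<union> B \<union> C) = span ((A \<union> B) \<union> (A \<union> C))" by (rule arg_cong[of _ _ span]) auto
  then have "dim (span (A \<union> B \<union> C)) + dim (span (A \<union> B) \<inter> span (A \<union> C)) =
      dim (span (A \<union> B)) + dim (span (A \<union> C))"
    using dim_sums_Int[OF subspace_span subspace_span, of "A \<union> B" "A \<union> C"] by (simp only: span_Un)
  moreover have "card (A \<union> B \<union> C) = card A + card B + card C"
    using fin assms(2-4) by (simp add: card_Un_disjoint Int_Un_distrib2)
  moreover have "card (A \<union> B) = card A + card B" "card (A \<union> C) = card A + card C"
    using fin assms(2,3) by (simp_all add: card_Un_disjoint)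
  ultimately show "dim (span (A \<union> B) \<inter> span (A \<union> C)) \<le> dim (span A)"
    using ind assms(1) by (simp add: dim_eq_card_independent)
qed

text \<open>Extend a basis \<open>A\<close> of \<open>e1\<close> to a basis of \<open>e2\<close> and
  halve the added vectors into \<open>B\<close> and \<open>C\<close>. The spans of
  \<open>A \<union> B\<close> and \<open>A \<union> C\<close> then have intersection
  \<open>e1\<close> and sum \<open>e2\<close>.\<close>

lemma flag_subspace_principal:
  assumes inf: "infinite (UNIV :: 'k set)" and e: "subspace e1" "subspace e2" "e1 \<subseteq> e2"
    and d: "dim e1 \<le> p" "p \<le> dim e2" "p - dim e1 = dim e2 - p"
  obtains x y where "x \<in> X_plus" "y \<in> X_plus" "flag_subspace e1 e2 = intrinsic_join x y"
proof -
  obtain A where A: "finite A" "A \<subseteq> e1" "independent A" "span A = e1" "card A = dim e1"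
    using basis_subspace_exists[OF e(1)] by blast
  have "A \<subseteq> e2" using A e by blast
  then obtain E where E: "A \<subseteq> E" "E \<subseteq> e2" "independent E" "e2 \<subseteq> span E"
    using maximal_independent_subset_extend[OF _ A(3)] by blast
  have spE: "span E = e2" using E e(2) by (metis span_subspace)
  have cE: "card E = dim e2" using E by (metis basis_card_eq_dim)
  have fE: "finite E" using E finiteI_independent by blast
  have "card (E - A) = dim e2 - dim e1" using A E cE by (simp add: card_Diff_subset)
  then have "p - dim e1 \<le> card (E - A)" using d by simp
  then obtain B where B: "B \<subseteq> E - A" "card B = p - dim e1"
    by (metis obtain_subset_with_card_n)
  define C where "C = E - A - B"
  have dis: "A \<inter> B = {}" "A \<inter> C = {}" "B \<inter> C = {}" and un: "A \<union> B \<union> C = E"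
    unfolding C_def using B(1) E(1) by blast+
  have fin: "finite B" "finite C"
    using finite_subset[OF B(1)] fE by (simp_all add: C_def)
  \<comment> \<open>The remainder has \<open>dim e2 - p\<close> elements, which equals
    \<open>card B\<close> by the symmetry of the dimensions about \<open>p\<close>.\<close>
  have cC: "card C = p - dim e1"
    using B \<open>card (E - A) = _\<close> fin d by (simp add: C_def card_Diff_subset)
  have ind: "independent (A \<union> B)" "independent (A \<union> C)"
    by (rule independent_mono[OF E(3)], use un in blast)+
  have "dim (span (A \<union> B)) = p" "dim (span (A \<union> C)) = p"
    using ind A B(2) cC d fin dis by (simp_all add: dim_eq_card_independent card_Un_disjoint)
  then have X: "span (A \<union> B) \<in> X_plus" "span (A \<union> C) \<in> X_plus" by (auto simp: X_plus_def)
  have "span (A \<union> B) \<inter> span (A \<union> C) = e1"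
    using span_Un_Int_independent[of A B C] E(3) un dis A(4) by simp
  moreover have "{u + v |u v. u \<in> span (A \<union> B) \<and> v \<in> span (A \<union> C)} = e2"
  proof -
    have "span ((A \<union> B) \<union> (A \<union> C)) = span E" by (rule arg_cong[of _ _ span]) (use un in auto)
    then show ?thesis by (simp only: span_Un[symmetric] spE)
  qed
  ultimately show thesis using that[OF X] intrinsic_join_eq[OF inf X] by simp
qed

text \<open>The symmetry is the dimension formula: intersection and sum have dimensions adding up to
  2p.\<close>

lemma intrinsic_join_flag:
  assumes "infinite (UNIV :: 'k set)" and x: "x \<in> X_plus" and y: "y \<in> X_plus"
  obtains e1 e2 where "flag3 e1 e2" "dim e1 \<le> p" "p \<le> dim e2" "p - dim e1 = dim e2 - p"
    "intrinsic_join x y = flag_subspace e1 e2"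
proof -
  let ?S = "{u + v |u v. u \<in> x \<and> v \<in> y}"
  have sub: "subspace x" "subspace y" and d: "dim x = p" "dim y = p"
    using x y by (auto simp: X_plus_def)
  have le: "x \<subseteq> ?S" using subset_sums(1)[OF sub] .
  then have "flag3 (x \<inter> y) ?S"
    using sub by (auto simp: flag3_def intro: subspace_inter subspace_sums)
  moreover have "dim (x \<inter> y) \<le> p" using dim_subset[of "x \<inter> y" x] d by simp
  moreover have "p \<le> dim ?S" using dim_subset[OF le] d by simp
  moreover have "p - dim (x \<inter> y) = dim ?S - p" using dim_sums_Int[OF sub] d by simp
  ultimately show thesis using that intrinsic_join_eq[OF assms] by blast
qed

end

theorem theorem3p11:
  fixes scale :: "'k::field \<Rightarrow> 'm::ab_group_add \<Rightarrow> 'm"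
    and Basis :: "'m set"
    and p q :: nat
  assumes "infinite (UNIV :: 'k set)"
    and "CHAR('k) \<noteq> 2"
    and "grassmannian_geometry scale Basis p q"
  shows "(\<forall>I. grassmannian_geometry.intrinsic_subspace scale p q I \<and> I \<noteq> {} \<longrightarrow>
            (\<exists>e1 e2. grassmannian_geometry.flag3 scale e1 e2 \<and>
               vector_space.dim scale e1 \<le> p \<and> p \<le> vector_space.dim scale e2 \<and>
               I = grassmannian_geometry.flag_subspace scale p e1 e2)) \<and>
         (\<forall>I. grassmannian_geometry.principal_intrinsic_subspace scale p q I \<longleftrightarrow>
            grassmannian_geometry.intrinsic_subspace scale p q I \<and>
            (\<exists>e1 e2. grassmannian_geometry.flag3 scale e1 e2 \<and>
               vector_space.dim scale e1 \<le> p \<and> p \<le> vector_space.dim scale e2 \<and>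
               p - vector_space.dim scale e1 = vector_space.dim scale e2 - p \<and>
               I = grassmannian_geometry.flag_subspace scale p e1 e2))"
proof -
  interpret grassmannian_geometry scale Basis p q by (fact assms(3))
  show ?thesis
  proof (intro conjI allI impI iffI)
    fix I assume I: "intrinsic_subspace I \<and> I \<noteq> {}"
    \<comment> \<open>Any point serves as base point; the dimension bounds follow from
      \<open>e1 \<subseteq> x\<close> and \<open>x \<subseteq> e2\<close>.\<close>
    then obtain x where x: "x \<in> I" by blast
    then have "dim x = p" using I by (auto simp: intrinsic_subspace_def X_plus_def)
    moreover obtain e1 e2 where e: "subspace e1" "subspace e2" "e1 \<subseteq> x" "x \<subseteq> e2"
        "I = flag_subspace e1 e2"
      using intrinsic_subspace_cases[OF assms(1) _ x] I by metis
    ultimately have "flag3 e1 e2" "dim e1 \<le> p" "p \<le> dim e2"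
      using dim_subset[OF e(3)] dim_subset[OF e(4)] by (auto simp: flag3_def)
    with e(5) show "\<exists>e1 e2. flag3 e1 e2 \<and> dim e1 \<le> p \<and> p \<le> dim e2 \<and> I = flag_subspace e1 e2"
      by blast
  next
    fix I assume "principal_intrinsic_subspace I"
    then obtain x y where xy: "x \<in> X_plus" "y \<in> X_plus" "I = intrinsic_join x y"
      by (auto simp: principal_intrinsic_subspace_def)
    obtain e1 e2 where e: "flag3 e1 e2" "dim e1 \<le> p" "p \<le> dim e2" "p - dim e1 = dim e2 - p"
        "I = flag_subspace e1 e2"
      using intrinsic_join_flag[OF assms(1) xy(1,2)] xy(3) by metis
    then show "intrinsic_subspace I"
      using flag_subspace_intrinsic by (simp add: flag3_def)
    show "\<exists>e1 e2. flag3 e1 e2 \<and> dim e1 \<le> p \<and> p \<le> dim e2 \<and> p - dim e1 = dim e2 - p \<and>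
        I = flag_subspace e1 e2"
      using e by blast
  next
    fix I assume "intrinsic_subspace I \<and> (\<exists>e1 e2. flag3 e1 e2 \<and> dim e1 \<le> p \<and> p \<le> dim e2 \<and>
      p - dim e1 = dim e2 - p \<and> I = flag_subspace e1 e2)"
    then obtain e1 e2 where e: "flag3 e1 e2" "dim e1 \<le> p" "p \<le> dim e2" "p - dim e1 = dim e2 - p"
        "I = flag_subspace e1 e2"
      by blast
    then obtain x y where "x \<in> X_plus" "y \<in> X_plus" "I = intrinsic_join x y"
      using flag_subspace_principal[OF assms(1)] unfolding flag3_def by metis
    then show "principal_intrinsic_subspace I" by (auto simp: principal_intrinsic_subspace_def)
  qed
qed

end
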